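(* Let $(X,d)$ be a complete semimetric space with triangle function $\Phi$, where $\Phi$ is one of $\Phi(u,v)=u+v$, $\Phi(u,v)=\max\{u,v\}$, or $\Phi(u,v)=(u^q+v^q)^{1/q}$ with $q>0$. Let $T\colon X\to X$ be a mapping for which there exist real numbers $\alpha,\beta$ with $0\le\alpha<1$, $\beta\ge 0$ and $0\le\alpha+\beta<1$ such that $$d(Tx,Ty)\le \alpha\, d(x,y)+\beta\, d(x,Tx)\quad\text{for all } x,y\in X.$$ Then $T$ has a unique fixed point $x^*$. Moreover, let $\delta=\alpha+\beta$, let $x_0\in X$ be arbitrary and let $x_n=T^nx_0$. Then for all $n\ge 0$: $$d(x_n,x^* )\le\frac{\delta^n}{1-\delta}\,d(x_0,x_1)\quad\text{if }\Phi(u,v)=u+v,$$ $$d(x_n,x^* )\le\delta^n\,d(x_0,x_1)\quad\text{if }\Phi(u,v)=\max\{u,v\},$$ $$d(x_n,x^* )\le\frac{\delta^n}{(1-\delta^q)^{1/q}}\,d(x_0,x_1)\quad\text{if }\Phi(u,v)=(u^q+v^q)^{1/q},\ q>0.$$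
   Context: $\mathbb{R}^+=[0,\infty)$. A semimetric space $(X,d)$ is a nonempty set $X$ with a function $d\colon X\times X\to\mathbb{R}^+$ such that for all $x,y\in X$: $d(x,y)=0$ if and only if $x=y$, and $d(x,y)=d(y,x)$. A function $\Phi\colon\mathbb{R}^+\times\mathbb{R}^+\to\mathbb{R}^+$ is a triangle function for $d$ if $\Phi$ is symmetric and non-decreasing in both of its arguments, $\Phi(0,0)=0$, and $d(x,y)\le\Phi(d(x,z),d(z,y))$ for all $x,y,z\in X$. A sequence $(x_n)$ in $X$ converges to $x\in X$ if $d(x_n,x)\to 0$; it is Cauchy if $d(x_n,x_m)\to 0$ as $n,m\to\infty$; $(X,d)$ is complete if every Cauchy sequence converges to some point of $X$. Convention: $0^0=1$. *)

theory Defs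
  imports "HOL-Analysis.Analysis"
begin

text \<open>The space is an arbitrary carrier set; values of the distance off the carrier are irrelevant.\<close>

locale Semimetric_space =
  fixes X :: "'a set" and d :: "'a \<Rightarrow> 'a \<Rightarrow> real"
  assumes nonempty: "X \<noteq> {}"
    and nonneg: "\<lbrakk>x \<in> X; y \<in> X\<rbrakk> \<Longrightarrow> 0 \<le> d x y"
    and zero: "\<lbrakk>x \<in> X; y \<in> X\<rbrakk> \<Longrightarrow> d x y = 0 \<longleftrightarrow> x = y"
    and commute: "\<lbrakk>x \<in> X; y \<in> X\<rbrakk> \<Longrightarrow> d x y = d y x"

definition semi_converges :: "'a set \<Rightarrow> ('a \<Rightarrow> 'a \<Rightarrow> real) \<Rightarrow> (nat \<Rightarrow> 'a) \<Rightarrow> 'a \<Rightarrow> bool" where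
  "semi_converges X d \<sigma> x \<longleftrightarrow>
     range \<sigma> \<subseteq> X \<and> x \<in> X \<and> (\<lambda>n. d (\<sigma> n) x) \<longlonglongrightarrow> 0"

definition semi_Cauchy :: "'a set \<Rightarrow> ('a \<Rightarrow> 'a \<Rightarrow> real) \<Rightarrow> (nat \<Rightarrow> 'a) \<Rightarrow> bool" where
  "semi_Cauchy X d \<sigma> \<longleftrightarrow>
     range \<sigma> \<subseteq> X \<and> (\<forall>\<epsilon>>0. \<exists>N. \<forall>n\<ge>N. \<forall>m\<ge>N. d (\<sigma> n) (\<sigma> m) < \<epsilon>)"

definition complete_semimetric_space :: "'a set \<Rightarrow> ('a \<Rightarrow> 'a \<Rightarrow> real) \<Rightarrow> bool" where
  "complete_semimetric_space X d \<longleftrightarrow>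
     Semimetric_space X d \<and> (\<forall>\<sigma>. semi_Cauchy X d \<sigma> \<longrightarrow> (\<exists>x\<in>X. semi_converges X d \<sigma> x))"

text \<open>A function on pairs of nonnegative reals is represented by a total function on pairs of reals
  of which only the values at nonnegative arguments are constrained.\<close>

definition triangle_function ::
    "'a set \<Rightarrow> ('a \<Rightarrow> 'a \<Rightarrow> real) \<Rightarrow> (real \<Rightarrow> real \<Rightarrow> real) \<Rightarrow> bool" where
  "triangle_function X d \<Phi> \<longleftrightarrow>
     (\<forall>u\<ge>0. \<forall>v\<ge>0. 0 \<le> \<Phi> u v) \<and>
     (\<forall>u\<ge>0. \<forall>v\<ge>0. \<Phi> u v = \<Phi> v u) \<and>
     (\<forall>u u' v v'. 0 \<le> u \<and> u \<le> u' \<and> 0 \<le> v \<and> v \<le> v' \<longrightarrow> \<Phi> u v \<le> \<Phi> u' v') \<and>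
     \<Phi> 0 0 = 0 \<and>
     (\<forall>x\<in>X. \<forall>y\<in>X. \<forall>z\<in>X. d x y \<le> \<Phi> (d x z) (d z y))"

definition eq_on_nonneg :: "(real \<Rightarrow> real \<Rightarrow> real) \<Rightarrow> (real \<Rightarrow> real \<Rightarrow> real) \<Rightarrow> bool" where
  "eq_on_nonneg \<Phi> \<Psi> \<longleftrightarrow> (\<forall>u\<ge>0. \<forall>v\<ge>0. \<Phi> u v = \<Psi> u v)"

end

theory Submission
  imports Defs
begin

text \<open>
  All three triangle functions are continuous, positively homogeneous, and satisfy
  \<open>\<Phi> 0 v = v\<close>; a fixed point exists for every triangle function with these properties.

  Consecutive points of an orbit satisfy \<open>d x\<^sub>n x\<^sub>n\<^sub>+\<^sub>1 \<le> \<delta>\<^sup>n d x\<^sub>0 x\<^sub>1\<close>. To see that the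
  orbit is Cauchy, one does not add up these steps (a general \<open>\<Phi>\<close> need not sum them well) but uses
  the contraction property for two distant points: if \<open>x\<close> and \<open>y\<close> are both moved by at most \<open>\<eta>\<close>, then \<open>e = d x y\<close>
  satisfies \<open>e \<le> \<Phi> \<eta> (\<Phi> (\<alpha> e + \<beta> \<eta>) \<eta>)\<close>. Divided by \<open>e\<close>, the right-hand side depends
  on \<open>t = \<eta> / e\<close> alone and tends to \<open>\<alpha> < 1\<close> as \<open>t\<close> tends to 0, so \<open>\<eta> / e\<close> is bounded away
  from 0 (\<open>almost_fixed_points_close\<close>). The limit \<open>p\<close> of the orbit is fixed, since \<open>p\<close> and \<open>T p\<close> are
  both within a small \<open>\<eta>\<close> of a late orbit point and hence within \<open>\<Phi> \<eta> \<eta> = \<eta> \<Phi> 1 1\<close> of each other.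

  The error bounds follow from a single step of the orbit. If \<open>p\<close> is fixed, then \<open>d (T x) p \<le> \<alpha> d x p\<close>, hence
  \<open>d x p \<le> \<Phi> (d x (T x)) (\<alpha> d x p)\<close> (\<open>dist_fixed_point_implicit\<close>). Solving this inequality for
  \<open>d x p\<close> with \<open>x = x\<^sub>n\<close>, and using \<open>\<alpha> \<le> \<delta>\<close>, gives the stated constants. The case \<open>u + v\<close> is the power case
  with \<open>q = 1\<close>.
\<close>

lemma triangle_function_mono:
  assumes "triangle_function X d \<Phi>" "0 \<le> u" "u \<le> u'" "0 \<le> v" "v \<le> v'"
  shows "\<Phi> u v \<le> \<Phi> u' v'"
  using assms unfolding triangle_function_def by blast

lemma triangle_function_nonneg:
  assumes "triangle_function X d \<Phi>" "0 \<le> u" "0 \<le> v"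
  shows "0 \<le> \<Phi> u v"
  using assms unfolding triangle_function_def by blast

lemma triangle_function_triangle:
  assumes "triangle_function X d \<Phi>" "x \<in> X" "y \<in> X" "z \<in> X"
  shows "d x y \<le> \<Phi> (d x z) (d z y)"
  using assms unfolding triangle_function_def by blast

section \<open>Orbits of the map\<close>

lemma funpow_in_carrier:
  assumes "T \<in> X \<rightarrow> X" "x \<in> X"
  shows "(T ^^ n) x \<in> X"
  using assms by (induction n) auto

lemma orbit_step_le:
  fixes \<alpha> \<beta> :: real
  assumes T: "T \<in> X \<rightarrow> X" and x: "x \<in> X" and nn: "0 \<le> \<alpha> + \<beta>"
    and contr: "\<forall>x\<in>X. \<forall>y\<in>X. d (T x) (T y) \<le> \<alpha> * d x y + \<beta> * d x (T x)"
  shows "d ((T ^^ n) x) (T ((T ^^ n) x)) \<le> (\<alpha> + \<beta>) ^ n * d x (T x)"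
proof (induction n)
  case 0
  show ?case by simp
next
  case (Suc n)
  let ?y = "(T ^^ n) x"
  have y: "?y \<in> X" "T ?y \<in> X" using funpow_in_carrier[OF T x, of n] T by auto
  have "d (T ?y) (T (T ?y)) \<le> \<alpha> * d ?y (T ?y) + \<beta> * d ?y (T ?y)"
    using contr y by blast
  also have "\<dots> = (\<alpha> + \<beta>) * d ?y (T ?y)" by (simp add: algebra_simps)
  also have "\<dots> \<le> (\<alpha> + \<beta>) * ((\<alpha> + \<beta>) ^ n * d x (T x))"
    by (rule mult_left_mono[OF Suc nn])
  finally show ?case by (simp add: mult.assoc)
qed

lemma orbit_step_tendsto_0:
  fixes \<alpha> \<beta> :: real
  assumes sm: "Semimetric_space X d" and T: "T \<in> X \<rightarrow> X" and x: "x \<in> X"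
    and nn: "0 \<le> \<alpha> + \<beta>" and less: "\<alpha> + \<beta> < 1"
    and contr: "\<forall>x\<in>X. \<forall>y\<in>X. d (T x) (T y) \<le> \<alpha> * d x y + \<beta> * d x (T x)"
  shows "(\<lambda>n. d ((T ^^ n) x) (T ((T ^^ n) x))) \<longlonglongrightarrow> 0"
proof (rule tendsto_sandwich[OF _ _ tendsto_const])
  show "\<forall>\<^sub>F n in sequentially. 0 \<le> d ((T ^^ n) x) (T ((T ^^ n) x))"
    using Semimetric_space.nonneg[OF sm] funpow_in_carrier[OF T x] T by (intro always_eventually) auto
  show "\<forall>\<^sub>F n in sequentially. d ((T ^^ n) x) (T ((T ^^ n) x)) \<le> (\<alpha> + \<beta>) ^ n * d x (T x)"
    using orbit_step_le[OF T x nn contr] by (intro always_eventually) auto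
  show "(\<lambda>n. (\<alpha> + \<beta>) ^ n * d x (T x)) \<longlonglongrightarrow> 0"
    using nn less by (intro tendsto_mult_left_zero LIMSEQ_power_zero) auto
qed

section \<open>Existence and uniqueness of the fixed point\<close>

text \<open>
  At \<open>t = 0\<close> the left-hand side below equals \<open>\<alpha>\<close>, so continuity leaves room for a positive \<open>t\<close>.
\<close>

lemma homogeneous_gap:
  fixes \<alpha> \<beta> :: real
  assumes cont: "continuous_on ({0..} \<times> {0..}) (\<lambda>(u, v). \<Phi> u v)"
    and sym: "\<And>u v :: real. 0 \<le> u \<Longrightarrow> 0 \<le> v \<Longrightarrow> \<Phi> u v = \<Phi> v u"
    and nonneg: "\<And>u v. 0 \<le> u \<Longrightarrow> 0 \<le> v \<Longrightarrow> (0 :: real) \<le> \<Phi> u v"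
    and unit: "\<And>v. 0 \<le> v \<Longrightarrow> \<Phi> 0 v = v"
    and "0 \<le> \<alpha>" "\<alpha> < 1" "0 \<le> \<beta>"
  obtains t where "0 < t" "\<Phi> t (\<Phi> (\<alpha> + \<beta> * t) t) < 1"
proof -
  let ?g = "\<lambda>t. \<Phi> t (\<Phi> (\<alpha> + \<beta> * t) t)"
  have inner: "continuous_on {0..} (\<lambda>t. \<Phi> (\<alpha> + \<beta> * t) t)"
  proof -
    have "continuous_on {0..} (\<lambda>t. (\<alpha> + \<beta> * t, t))" by (intro continuous_intros)
    moreover have "(\<lambda>t. (\<alpha> + \<beta> * t, t)) ` {0..} \<subseteq> {0..} \<times> {0..}"
      using assms(5,7) by auto
    ultimately show ?thesis using continuous_on_compose2[OF cont, of "{0..}" "\<lambda>t. (\<alpha> + \<beta> * t, t)"] by simp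
  qed
  have "continuous_on {0..} ?g"
  proof -
    have "continuous_on {0..} (\<lambda>t. (t, \<Phi> (\<alpha> + \<beta> * t) t))"
      by (intro continuous_intros inner)
    moreover have "(\<lambda>t. (t, \<Phi> (\<alpha> + \<beta> * t) t)) ` {0..} \<subseteq> {0..} \<times> {0..}"
      using nonneg assms(5,7) by auto
    ultimately show ?thesis using continuous_on_compose2[OF cont, of "{0..}" "\<lambda>t. (t, \<Phi> (\<alpha> + \<beta> * t) t)"] by simp
  qed
  then have "(?g \<longlongrightarrow> ?g 0) (at 0 within {0..})"
    unfolding continuous_on_def by (elim ballE[of _ _ 0]) auto
  moreover have "?g 0 = \<alpha>" using unit sym[of \<alpha> 0] assms(5) by simp
  ultimately have "(?g \<longlongrightarrow> \<alpha>) (at_right 0)"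
    by (auto intro: tendsto_within_subset)
  then have "\<forall>\<^sub>F t in at_right 0. ?g t < 1"
    using \<open>\<alpha> < 1\<close> by (rule order_tendstoD(2))
  then have "\<forall>\<^sub>F t in at_right 0. 0 < t \<and> ?g t < 1"
    using eventually_at_right_less[of "0 :: real"] by eventually_elim auto
  then obtain t where "0 < t \<and> ?g t < 1"
    using eventually_happens' trivial_limit_at_right_real by blast
  then show thesis using that by blast
qed

text \<open>
  The path \<open>x\<close>, \<open>T x\<close>, \<open>T y\<close>, \<open>y\<close> and the contraction property bound \<open>e = d x y\<close> in terms of
  itself. If \<open>e \<ge> \<epsilon>\<close>, then the displacements are at most \<open>t e\<close>, and homogeneity lets the factor \<open>e\<close> be
  pulled out; the remaining constant is less than 1 by the choice of \<open>t\<close>.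
\<close>

lemma almost_fixed_points_close:
  fixes \<alpha> \<beta> :: real
  assumes sm: "Semimetric_space X d" and tri: "triangle_function X d \<Phi>"
    and hom: "\<And>c u v. 0 \<le> c \<Longrightarrow> 0 \<le> u \<Longrightarrow> 0 \<le> v \<Longrightarrow> \<Phi> (c * u) (c * v) = c * \<Phi> u v"
    and T: "T \<in> X \<rightarrow> X" and ab: "0 \<le> \<alpha>" "0 \<le> \<beta>"
    and contr: "\<forall>x\<in>X. \<forall>y\<in>X. d (T x) (T y) \<le> \<alpha> * d x y + \<beta> * d x (T x)"
    and t: "0 < t" "\<Phi> t (\<Phi> (\<alpha> + \<beta> * t) t) < 1"
    and xy: "x \<in> X" "y \<in> X"
    and eps: "0 < \<epsilon>" and mx: "d x (T x) \<le> t * \<epsilon>" and my: "d y (T y) \<le> t * \<epsilon>"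
  shows "d x y < \<epsilon>"
proof (rule ccontr)
  define e where "e = d x y"
  assume "\<not> d x y < \<epsilon>"
  then have e: "\<epsilon> \<le> e" "0 < e" using eps by (auto simp: e_def)
  have te: "t * \<epsilon> \<le> e * t" using e t(1) by (simp add: mult.commute)
  have TX: "T x \<in> X" "T y \<in> X" using T xy by auto
  note nonneg = Semimetric_space.nonneg[OF sm]
  have "d (T x) (T y) \<le> \<alpha> * e + \<beta> * d x (T x)"
    using contr xy by (auto simp: e_def)
  also have "\<dots> \<le> \<alpha> * e + \<beta> * (e * t)"
    using mx te ab(2) by (intro add_left_mono mult_left_mono) auto
  finally have mid: "d (T x) (T y) \<le> e * (\<alpha> + \<beta> * t)" by (simp add: algebra_simps)
  have last_step: "d (T y) y \<le> e * t"
    using my te Semimetric_space.commute[OF sm, of "T y" y] TX xy by simp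
  have "d (T x) y \<le> \<Phi> (d (T x) (T y)) (d (T y) y)"
    using triangle_function_triangle[OF tri] TX xy by blast
  also have "\<dots> \<le> \<Phi> (e * (\<alpha> + \<beta> * t)) (e * t)"
    using mid last_step nonneg TX xy by (intro triangle_function_mono[OF tri]) auto
  also have "\<dots> = e * \<Phi> (\<alpha> + \<beta> * t) t"
    using e t ab by (intro hom) auto
  finally have tail: "d (T x) y \<le> e * \<Phi> (\<alpha> + \<beta> * t) t" .
  have "e \<le> \<Phi> (d x (T x)) (d (T x) y)"
    using triangle_function_triangle[OF tri] TX xy by (simp add: e_def)
  also have "\<dots> \<le> \<Phi> (e * t) (e * \<Phi> (\<alpha> + \<beta> * t) t)"
    using mx te tail nonneg TX xy by (intro triangle_function_mono[OF tri]) auto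
  also have "\<dots> = e * \<Phi> t (\<Phi> (\<alpha> + \<beta> * t) t)"
    using e t ab by (intro hom triangle_function_nonneg[OF tri]) auto
  also have "\<dots> < e * 1"
    using e(2) t(2) by (rule mult_strict_left_mono[rotated])
  finally show False by simp
qed

text \<open>
  Completeness gives a limit \<open>p\<close> of the orbit. The points \<open>p\<close> and \<open>T p\<close> are compared through
  \<open>x\<^sub>n\<^sub>+\<^sub>1\<close>, and \<open>\<Phi>\<close> is evaluated only at the larger of the two distances, which tends to 0.
\<close>

lemma fixed_point_exists:
  fixes \<alpha> \<beta> :: real
  assumes compl: "complete_semimetric_space X d" and tri: "triangle_function X d \<Phi>"
    and hom: "\<And>c u v. 0 \<le> c \<Longrightarrow> 0 \<le> u \<Longrightarrow> 0 \<le> v \<Longrightarrow> \<Phi> (c * u) (c * v) = c * \<Phi> u v"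
    and cont: "continuous_on ({0..} \<times> {0..}) (\<lambda>(u, v). \<Phi> u v)"
    and unit: "\<And>v. 0 \<le> v \<Longrightarrow> \<Phi> 0 v = v"
    and T: "T \<in> X \<rightarrow> X" and ab: "0 \<le> \<alpha>" "0 \<le> \<beta>" "\<alpha> + \<beta> < 1"
    and contr: "\<forall>x\<in>X. \<forall>y\<in>X. d (T x) (T y) \<le> \<alpha> * d x y + \<beta> * d x (T x)"
  shows "\<exists>p\<in>X. T p = p"
proof -
  have sm: "Semimetric_space X d" using compl by (simp add: complete_semimetric_space_def)
  note nonneg = Semimetric_space.nonneg[OF sm] and commute = Semimetric_space.commute[OF sm]
  obtain t where t: "0 < t" "\<Phi> t (\<Phi> (\<alpha> + \<beta> * t) t) < 1"
  proof (rule homogeneous_gap[OF cont _ _ unit ab(1) _ ab(2)])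
    show "\<Phi> u v = \<Phi> v u" if "0 \<le> u" "0 \<le> v" for u v
      using tri that unfolding triangle_function_def by blast
  qed (use ab triangle_function_nonneg[OF tri] in auto)
  obtain x where x: "x \<in> X" using Semimetric_space.nonempty[OF sm] by blast
  define \<sigma> where "\<sigma> n = (T ^^ n) x" for n
  have \<sigma>_in: "\<sigma> n \<in> X" and \<sigma>_Suc: "\<sigma> (Suc n) = T (\<sigma> n)" for n
    using funpow_in_carrier[OF T x] by (auto simp: \<sigma>_def)
  have steps: "(\<lambda>n. d (\<sigma> n) (T (\<sigma> n))) \<longlonglongrightarrow> 0"
    unfolding \<sigma>_def using ab by (intro orbit_step_tendsto_0[OF sm T x _ _ contr]) auto
  have "semi_Cauchy X d \<sigma>"
    unfolding semi_Cauchy_def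
  proof (intro conjI allI impI)
    fix \<epsilon> :: real
    assume eps: "0 < \<epsilon>"
    then have "\<forall>\<^sub>F n in sequentially. d (\<sigma> n) (T (\<sigma> n)) < t * \<epsilon>"
      using t(1) by (intro order_tendstoD(2)[OF steps]) auto
    then obtain N where N: "\<And>n. N \<le> n \<Longrightarrow> d (\<sigma> n) (T (\<sigma> n)) < t * \<epsilon>"
      by (auto simp: eventually_sequentially)
    show "\<exists>N. \<forall>n\<ge>N. \<forall>m\<ge>N. d (\<sigma> n) (\<sigma> m) < \<epsilon>"
      using almost_fixed_points_close[OF sm tri hom T ab(1,2) contr t \<sigma>_in \<sigma>_in eps] N
      by (meson less_imp_le)
  qed (use \<sigma>_in in auto)
  then obtain p where "p \<in> X" "semi_converges X d \<sigma> p"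
    using compl unfolding complete_semimetric_space_def by blast
  then have p: "p \<in> X" and lim: "(\<lambda>n. d (\<sigma> n) p) \<longlonglongrightarrow> 0" by (auto simp: semi_converges_def)
  have Tp: "T p \<in> X" using T p by auto
  define \<eta> where "\<eta> n = max (d (\<sigma> (Suc n)) p) (\<alpha> * d (\<sigma> n) p + \<beta> * d (\<sigma> n) (T (\<sigma> n)))" for n
  have "(\<lambda>n. d (\<sigma> (Suc n)) p) \<longlonglongrightarrow> 0" using lim by (rule LIMSEQ_Suc)
  then have "\<eta> \<longlonglongrightarrow> max 0 (\<alpha> * 0 + \<beta> * 0)"
    unfolding \<eta>_def by (intro tendsto_intros lim steps)
  then have \<eta>_lim: "(\<lambda>n. \<eta> n * \<Phi> 1 1) \<longlonglongrightarrow> 0"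
    by (intro tendsto_mult_left_zero) simp
  have bound: "d p (T p) \<le> \<eta> n * \<Phi> 1 1" for n
  proof -
    have "d (\<sigma> (Suc n)) (T p) \<le> \<alpha> * d (\<sigma> n) p + \<beta> * d (\<sigma> n) (T (\<sigma> n))"
      using contr \<sigma>_in p by (auto simp: \<sigma>_Suc)
    then have le: "d p (\<sigma> (Suc n)) \<le> \<eta> n" "d (\<sigma> (Suc n)) (T p) \<le> \<eta> n"
      using commute[OF p \<sigma>_in] by (auto simp: \<eta>_def)
    have "d p (T p) \<le> \<Phi> (d p (\<sigma> (Suc n))) (d (\<sigma> (Suc n)) (T p))"
      using triangle_function_triangle[OF tri] p Tp \<sigma>_in by blast
    also have "\<dots> \<le> \<Phi> (\<eta> n) (\<eta> n)"
      using le nonneg p Tp \<sigma>_in by (intro triangle_function_mono[OF tri]) auto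
    also have "\<dots> = \<eta> n * \<Phi> 1 1"
      using hom[of "\<eta> n" 1 1] le(1) nonneg[OF p \<sigma>_in, of "Suc n"] by simp
    finally show ?thesis .
  qed
  have "d p (T p) \<le> 0"
    using bound by (intro LIMSEQ_le_const[OF \<eta>_lim]) auto
  then have "d p (T p) = 0" using nonneg[OF p Tp] by simp
  then have "p = T p" using Semimetric_space.zero[OF sm p Tp] by blast
  then show ?thesis using p by metis
qed

lemma fixed_point_unique:
  fixes \<alpha> \<beta> :: real
  assumes sm: "Semimetric_space X d" and "\<alpha> < 1"
    and contr: "\<forall>x\<in>X. \<forall>y\<in>X. d (T x) (T y) \<le> \<alpha> * d x y + \<beta> * d x (T x)"
    and p: "p \<in> X" "T p = p" and r: "r \<in> X" "T r = r"
  shows "p = r"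
proof -
  have "d p p = 0" using Semimetric_space.zero[OF sm] p by blast
  then have "d p r \<le> \<alpha> * d p r" using contr p r by fastforce
  then have "(1 - \<alpha>) * d p r \<le> 0" by (simp add: algebra_simps)
  then have "d p r \<le> 0" using \<open>\<alpha> < 1\<close> by (simp add: mult_le_0_iff)
  then show ?thesis
    using Semimetric_space.nonneg[OF sm] Semimetric_space.zero[OF sm] p r by (metis order_antisym)
qed

section \<open>Error bounds\<close>

text \<open>
  The contraction property is not symmetric: putting the fixed point first makes the \<open>\<beta>\<close>-term
  vanish.
\<close>

lemma dist_fixed_point_implicit:
  fixes \<alpha> \<beta> :: real
  assumes sm: "Semimetric_space X d" and tri: "triangle_function X d \<Phi>"
    and T: "T \<in> X \<rightarrow> X"
    and contr: "\<forall>x\<in>X. \<forall>y\<in>X. d (T x) (T y) \<le> \<alpha> * d x y + \<beta> * d x (T x)"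
    and p: "p \<in> X" "T p = p" and x: "x \<in> X"
  shows "d x p \<le> \<Phi> (d x (T x)) (\<alpha> * d x p)"
proof -
  note commute = Semimetric_space.commute[OF sm] and nonneg = Semimetric_space.nonneg[OF sm]
  have Tx: "T x \<in> X" using T x by auto
  have "d p p = 0" using Semimetric_space.zero[OF sm] p by blast
  moreover have "d (T p) (T x) \<le> \<alpha> * d p x + \<beta> * d p (T p)" using contr p x by blast
  ultimately have shrink: "d (T x) p \<le> \<alpha> * d x p"
    using commute p x Tx by (metis add.right_neutral mult_zero_right)
  have "d x p \<le> \<Phi> (d x (T x)) (d (T x) p)"
    using triangle_function_triangle[OF tri] p x Tx by blast
  also have "\<dots> \<le> \<Phi> (d x (T x)) (\<alpha> * d x p)"
    using shrink nonneg p x Tx by (intro triangle_function_mono[OF tri]) auto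
  finally show ?thesis .
qed

lemma le_max_self_imp_le:
  fixes a e \<alpha> :: real
  assumes "e \<le> max a (\<alpha> * e)" "\<alpha> < 1" "0 \<le> a"
  shows "e \<le> a"
proof (rule ccontr)
  assume "\<not> e \<le> a"
  then have "0 < e" "e \<le> \<alpha> * e" using assms by (auto simp: le_max_iff_disj)
  moreover have "\<alpha> * e < 1 * e"
    using \<open>\<alpha> < 1\<close> \<open>0 < e\<close> by (rule mult_strict_right_mono)
  ultimately show False by simp
qed

lemma le_power_mean_self_imp_le:
  fixes a e \<alpha> \<delta> q :: real
  assumes le: "e \<le> (a powr q + (\<alpha> * e) powr q) powr (1 / q)"
    and q: "0 < q" and nn: "0 \<le> a" "0 \<le> e" and \<alpha>: "0 \<le> \<alpha>" "\<alpha> \<le> \<delta>" "\<delta> < 1"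
  shows "e \<le> a / (1 - \<delta> powr q) powr (1 / q)"
proof -
  have "\<delta> powr q < 1 powr q" using \<alpha> q by (intro powr_less_mono2) auto
  then have pos: "0 < 1 - \<delta> powr q" by simp
  have "e powr q \<le> ((a powr q + (\<alpha> * e) powr q) powr (1 / q)) powr q"
    using le nn q by (intro powr_mono2) auto
  also have "\<dots> = a powr q + \<alpha> powr q * e powr q"
    using q nn \<alpha> by (simp add: powr_powr powr_mult)
  also have "\<dots> \<le> a powr q + \<delta> powr q * e powr q"
    using \<alpha> q by (intro add_left_mono mult_right_mono powr_mono2) auto
  finally have "e powr q \<le> a powr q / (1 - \<delta> powr q)"
    using pos by (simp add: field_simps)
  then have "(e powr q) powr (1 / q) \<le> (a powr q / (1 - \<delta> powr q)) powr (1 / q)"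
    using q by (intro powr_mono2) auto
  then show ?thesis using q nn pos by (simp add: powr_powr powr_divide)
qed

section \<open>The three triangle functions\<close>

lemma add_eq_power_mean:
  assumes "eq_on_nonneg \<Phi> (\<lambda>u v. u + v)"
  shows "eq_on_nonneg \<Phi> (\<lambda>u v. (u powr 1 + v powr 1) powr (1 / 1))"
  using assms by (auto simp: eq_on_nonneg_def)

lemma max_homogeneous_continuous:
  assumes eq: "eq_on_nonneg \<Phi> (\<lambda>u v. max u v)"
  shows "0 \<le> c \<Longrightarrow> 0 \<le> u \<Longrightarrow> 0 \<le> v \<Longrightarrow> \<Phi> (c * u) (c * v) = c * \<Phi> u v"
    and "continuous_on ({0..} \<times> {0..}) (\<lambda>(u, v). \<Phi> u v)"
    and "0 \<le> v \<Longrightarrow> \<Phi> 0 v = v"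
proof -
  have \<Phi>: "\<Phi> u v = max u v" if "0 \<le> u" "0 \<le> v" for u v
    using eq that by (simp add: eq_on_nonneg_def)
  show "0 \<le> c \<Longrightarrow> 0 \<le> u \<Longrightarrow> 0 \<le> v \<Longrightarrow> \<Phi> (c * u) (c * v) = c * \<Phi> u v"
    by (simp add: \<Phi> max_mult_distrib_left)
  have "continuous_on ({0..} \<times> {0..}) (\<lambda>z :: real \<times> real. max (fst z) (snd z))"
    by (intro continuous_intros)
  then show "continuous_on ({0..} \<times> {0..}) (\<lambda>(u, v). \<Phi> u v)"
    by (rule continuous_on_eq) (auto simp: \<Phi>)
  show "0 \<le> v \<Longrightarrow> \<Phi> 0 v = v" by (simp add: \<Phi>)
qed

lemma power_mean_homogeneous_continuous:
  assumes q: "0 < q" and eq: "eq_on_nonneg \<Phi> (\<lambda>u v. (u powr q + v powr q) powr (1 / q))"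
  shows "0 \<le> c \<Longrightarrow> 0 \<le> u \<Longrightarrow> 0 \<le> v \<Longrightarrow> \<Phi> (c * u) (c * v) = c * \<Phi> u v"
    and "continuous_on ({0..} \<times> {0..}) (\<lambda>(u, v). \<Phi> u v)"
    and "0 \<le> v \<Longrightarrow> \<Phi> 0 v = v"
proof -
  have \<Phi>: "\<Phi> u v = (u powr q + v powr q) powr (1 / q)" if "0 \<le> u" "0 \<le> v" for u v
    using eq that by (simp add: eq_on_nonneg_def)
  show "\<Phi> (c * u) (c * v) = c * \<Phi> u v" if "0 \<le> c" "0 \<le> u" "0 \<le> v"
  proof -
    have "(c * u) powr q + (c * v) powr q = c powr q * (u powr q + v powr q)"
      using that by (simp add: powr_mult distrib_left)
    then show ?thesis using that q by (simp add: \<Phi> powr_mult powr_powr)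
  qed
  have "continuous_on ({0..} \<times> {0..})
      (\<lambda>z :: real \<times> real. (fst z powr q + snd z powr q) powr (1 / q))"
    using q by (intro continuous_on_powr' continuous_intros) auto
  then show "continuous_on ({0..} \<times> {0..}) (\<lambda>(u, v). \<Phi> u v)"
    by (rule continuous_on_eq) (auto simp: \<Phi>)
  show "0 \<le> v \<Longrightarrow> \<Phi> 0 v = v" using q by (simp add: \<Phi> powr_powr)
qed

theorem corollary2p1:
  fixes X :: "'a set" and d :: "'a \<Rightarrow> 'a \<Rightarrow> real" and \<Phi> :: "real \<Rightarrow> real \<Rightarrow> real"
    and T :: "'a \<Rightarrow> 'a" and \<alpha> \<beta> \<delta> :: real
  assumes "complete_semimetric_space X d"
    and "triangle_function X d \<Phi>"
    and "eq_on_nonneg \<Phi> (\<lambda>u v. u + v) \<or>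
         eq_on_nonneg \<Phi> (\<lambda>u v. max u v) \<or>
         (\<exists>q>0. eq_on_nonneg \<Phi> (\<lambda>u v. (u powr q + v powr q) powr (1 / q)))"
    and "T \<in> X \<rightarrow> X"
    and "0 \<le> \<alpha>" and "\<alpha> < 1" and "0 \<le> \<beta>" and "0 \<le> \<alpha> + \<beta>" and "\<alpha> + \<beta> < 1"
    and "\<forall>x\<in>X. \<forall>y\<in>X. d (T x) (T y) \<le> \<alpha> * d x y + \<beta> * d x (T x)"
    and "\<delta> = \<alpha> + \<beta>"
  shows "(\<exists>!x. x \<in> X \<and> T x = x) \<and>
    (\<forall>x'. x' \<in> X \<and> T x' = x' \<longrightarrow> (\<forall>x\<^sub>0\<in>X. \<forall>n.
      (eq_on_nonneg \<Phi> (\<lambda>u v. u + v) \<longrightarrow>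
         d ((T ^^ n) x\<^sub>0) x' \<le> \<delta> ^ n / (1 - \<delta>) * d x\<^sub>0 (T x\<^sub>0)) \<and>
      (eq_on_nonneg \<Phi> (\<lambda>u v. max u v) \<longrightarrow>
         d ((T ^^ n) x\<^sub>0) x' \<le> \<delta> ^ n * d x\<^sub>0 (T x\<^sub>0)) \<and>
      (\<forall>q>0. eq_on_nonneg \<Phi> (\<lambda>u v. (u powr q + v powr q) powr (1 / q)) \<longrightarrow>
         d ((T ^^ n) x\<^sub>0) x' \<le> \<delta> ^ n / (1 - \<delta> powr q) powr (1 / q) * d x\<^sub>0 (T x\<^sub>0))))"
proof -
  note contr = assms(10)
  have sm: "Semimetric_space X d" using assms(1) by (simp add: complete_semimetric_space_def)
  have q_or_max: "eq_on_nonneg \<Phi> (\<lambda>u v. max u v) \<or>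
      (\<exists>q>0. eq_on_nonneg \<Phi> (\<lambda>u v. (u powr q + v powr q) powr (1 / q)))"
    using assms(3) add_eq_power_mean[of \<Phi>] zero_less_one by blast
  have ex: "\<exists>p\<in>X. T p = p"
    using q_or_max
  proof (elim disjE exE conjE)
    assume "eq_on_nonneg \<Phi> (\<lambda>u v. max u v)"
    note \<Phi> = max_homogeneous_continuous[OF this]
    show ?thesis
      by (rule fixed_point_exists[OF assms(1,2) \<Phi> assms(4,5,7,9) contr])
  next
    fix q :: real
    assume "0 < q" "eq_on_nonneg \<Phi> (\<lambda>u v. (u powr q + v powr q) powr (1 / q))"
    note \<Phi> = power_mean_homogeneous_continuous[OF this]
    show ?thesis
      by (rule fixed_point_exists[OF assms(1,2) \<Phi> assms(4,5,7,9) contr])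
  qed
  then have ex1: "\<exists>!x. x \<in> X \<and> T x = x"
    using fixed_point_unique[OF sm assms(6) contr] by blast
  moreover have "(eq_on_nonneg \<Phi> (\<lambda>u v. u + v) \<longrightarrow>
         d ((T ^^ n) x) p \<le> \<delta> ^ n / (1 - \<delta>) * d x (T x)) \<and>
      (eq_on_nonneg \<Phi> (\<lambda>u v. max u v) \<longrightarrow>
         d ((T ^^ n) x) p \<le> \<delta> ^ n * d x (T x)) \<and>
      (\<forall>q>0. eq_on_nonneg \<Phi> (\<lambda>u v. (u powr q + v powr q) powr (1 / q)) \<longrightarrow>
         d ((T ^^ n) x) p \<le> \<delta> ^ n / (1 - \<delta> powr q) powr (1 / q) * d x (T x))"
    if p: "p \<in> X" "T p = p" and x: "x \<in> X" for p x n
  proof -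
    define y where "y = (T ^^ n) x"
    have y: "y \<in> X" "T y \<in> X"
      using funpow_in_carrier[OF assms(4) x] assms(4) by (auto simp: y_def)
    have nn: "0 \<le> d y (T y)" "0 \<le> d y p"
      using Semimetric_space.nonneg[OF sm] y p by auto
    have step: "d y (T y) \<le> \<delta> ^ n * d x (T x)"
      using orbit_step_le[OF assms(4) x assms(8) contr] by (simp add: y_def assms(11))
    have impl: "d y p \<le> \<Phi> (d y (T y)) (\<alpha> * d y p)"
      by (rule dist_fixed_point_implicit[OF sm assms(2,4) contr p y(1)])
    have max_bound: "d y p \<le> \<delta> ^ n * d x (T x)" if "eq_on_nonneg \<Phi> (\<lambda>u v. max u v)"
    proof -
      have "d y p \<le> max (d y (T y)) (\<alpha> * d y p)"
        using impl that nn assms(5) by (simp add: eq_on_nonneg_def)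
      then show ?thesis using le_max_self_imp_le[OF _ assms(6) nn(1)] step by force
    qed
    have q_bound: "d y p \<le> \<delta> ^ n / (1 - \<delta> powr q) powr (1 / q) * d x (T x)"
      if q: "0 < q" and eq: "eq_on_nonneg \<Phi> (\<lambda>u v. (u powr q + v powr q) powr (1 / q))" for q
    proof -
      have "d y p \<le> (d y (T y) powr q + (\<alpha> * d y p) powr q) powr (1 / q)"
        using impl eq nn assms(5) by (simp add: eq_on_nonneg_def)
      then have "d y p \<le> d y (T y) / (1 - \<delta> powr q) powr (1 / q)"
        using q nn assms by (intro le_power_mean_self_imp_le[where \<alpha> = \<alpha>]) auto
      also have "\<dots> \<le> (\<delta> ^ n * d x (T x)) / (1 - \<delta> powr q) powr (1 / q)"
        using step by (intro divide_right_mono) auto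
      finally show ?thesis by simp
    qed
    have "d y p \<le> \<delta> ^ n / (1 - \<delta>) * d x (T x)" if "eq_on_nonneg \<Phi> (\<lambda>u v. u + v)"
      using q_bound[OF zero_less_one add_eq_power_mean[OF that]] assms by simp
    then show ?thesis using max_bound q_bound unfolding y_def by blast
  qed
  ultimately show ?thesis by blast
qed

end
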